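(* Let $n\ge 2$, let $\mathcal{G}$ be a linear congestion game with $n$ players, and let $\Gamma=(\gamma_{ij})\in\mathbb{R}^{n\times n}$ be a symmetric matrix with $\gamma_{ij}\ge 0$ for all $i,j$, such that $(\mathcal{G},\Gamma)$ is a linear congestion game with restricted altruistic social context, normalized so that $\gamma_{ii}=1$ for all $i$ (hence $\gamma_{ij}\in[0,1]$ for all $i,j$). Then $(\mathcal{G},\Gamma)$ admits an exact potential function.
   Context: Linear congestion game: a set of players $[n]=\{1,\dots,n\}$, $n\ge 2$, a finite set $E$ of resources, for each player $i$ a non-empty set $S_i\subseteq 2^E$ of strategies (each strategy is a non-empty subset of $E$), and for each $e\in E$ a latency function $\ell_e(x)=\alpha_e x+\beta_e$ with $\alpha_e,\beta_e\ge 0$. A strategy profile is $S=(s_1,\dots,s_n)$ with $s_i\in S_i$. The congestion of $e$ in $S$ is $n_e(S)=|\{j\in[n]:e\in s_j\}|$, and the cost of player $i$ in the underlying game is $c_i(S)=\sum_{e\in s_i}(\alpha_e n_e(S)+\beta_e)$. For $t\in S_i$, $S_{-i}\diamond t$ denotes the profile obtained from $S$ by replacing $s_i$ with $t$. A linear congestion game with altruistic social context is a pair $(\mathcal{G},\Gamma)$ where $\mathcal{G}$ is a linear congestion game with $n$ players and $\Gamma=(\gamma_{ij})\in\mathbb{R}^{n\times n}$ has non-negative entries; players and strategies are those of $\mathcal{G}$, but the cost of player $i$ in $S$ is $\widehat{c}_i(S)=\sum_{j\in[n]}\gamma_{ij}\,c_j(S)$. The social context is restricted if $\gamma_{ii}\ge\gamma_{ij}$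 for all $i,j\in[n]$; in this case it is normalized so that $\gamma_{ii}=1$ for every $i$. An exact potential function for $(\mathcal{G},\Gamma)$ is a real-valued function $\Phi$ on strategy profiles such that $\Phi(S)-\Phi(S_{-i}\diamond t)=\widehat{c}_i(S)-\widehat{c}_i(S_{-i}\diamond t)$ for every profile $S$, player $i$ and $t\in S_i$. *)

theory Defs
  imports Complex_Main "HOL-Library.FuncSet"
begin

record 'e congestion_game =
  num_players :: nat
  resources :: "'e set"
  strategies :: "nat \<Rightarrow> 'e set set"
  slope :: "'e \<Rightarrow> real"
  offset :: "'e \<Rightarrow> real"

definition players :: "'e congestion_game \<Rightarrow> nat set" where
  "players G = {1..num_players G}"

definition linear_congestion_game :: "'e congestion_game \<Rightarrow> bool" where
  "linear_congestion_game G \<longleftrightarrow>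
     num_players G \<ge> 2 \<and>
     finite (resources G) \<and>
     (\<forall>i\<in>players G. strategies G i \<noteq> {} \<and> strategies G i \<subseteq> Pow (resources G) - {{}}) \<and>
     (\<forall>e\<in>resources G. slope G e \<ge> 0 \<and> offset G e \<ge> 0)"

definition latency :: "'e congestion_game \<Rightarrow> 'e \<Rightarrow> real \<Rightarrow> real" where
  "latency G e x = slope G e * x + offset G e"

(* Profiles are extensional functions (undefined outside the players), so they are in
   bijection with tuples; S(i := t) is again a profile for i a player and t a strategy of i. *)
definition profiles :: "'e congestion_game \<Rightarrow> (nat \<Rightarrow> 'e set) set" where
  "profiles G = (\<Pi>\<^sub>E i\<in>players G. strategies G i)"

definition congestion ::
  "'e congestion_game \<Rightarrow> (nat \<Rightarrow> 'e set) \<Rightarrow> 'e \<Rightarrow> nat" where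
  "congestion G S e = card {j \<in> players G. e \<in> S j}"

definition cost ::
  "'e congestion_game \<Rightarrow> nat \<Rightarrow> (nat \<Rightarrow> 'e set) \<Rightarrow> real" where
  "cost G i S = (\<Sum>e\<in>S i. latency G e (real (congestion G S e)))"

(* A social context is an n-by-n matrix; only its entries at players are meaningful. *)
definition altruistic_game ::
  "'e congestion_game \<Rightarrow> (nat \<Rightarrow> nat \<Rightarrow> real) \<Rightarrow> bool" where
  "altruistic_game G \<Gamma> \<longleftrightarrow>
     linear_congestion_game G \<and> (\<forall>i\<in>players G. \<forall>j\<in>players G. \<Gamma> i j \<ge> 0)"

definition altruistic_cost ::
  "'e congestion_game \<Rightarrow> (nat \<Rightarrow> nat \<Rightarrow> real) \<Rightarrow> nat \<Rightarrow> (nat \<Rightarrow> 'e set) \<Rightarrow> real" where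
  "altruistic_cost G \<Gamma> i S = (\<Sum>j\<in>players G. \<Gamma> i j * cost G j S)"

definition restricted_context ::
  "'e congestion_game \<Rightarrow> (nat \<Rightarrow> nat \<Rightarrow> real) \<Rightarrow> bool" where
  "restricted_context G \<Gamma> \<longleftrightarrow> (\<forall>i\<in>players G. \<forall>j\<in>players G. \<Gamma> i i \<ge> \<Gamma> i j)"

definition normalized_context ::
  "'e congestion_game \<Rightarrow> (nat \<Rightarrow> nat \<Rightarrow> real) \<Rightarrow> bool" where
  "normalized_context G \<Gamma> \<longleftrightarrow> (\<forall>i\<in>players G. \<Gamma> i i = 1)"

definition symmetric_context ::
  "'e congestion_game \<Rightarrow> (nat \<Rightarrow> nat \<Rightarrow> real) \<Rightarrow> bool" where
  "symmetric_context G \<Gamma> \<longleftrightarrow> (\<forall>i\<in>players G. \<forall>j\<in>players G. \<Gamma> i j = \<Gamma> j i)"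

definition exact_potential ::
  "'e congestion_game \<Rightarrow> (nat \<Rightarrow> nat \<Rightarrow> real) \<Rightarrow> ((nat \<Rightarrow> 'e set) \<Rightarrow> real) \<Rightarrow> bool" where
  "exact_potential G \<Gamma> \<Phi> \<longleftrightarrow>
     (\<forall>S\<in>profiles G. \<forall>i\<in>players G. \<forall>t\<in>strategies G i.
        \<Phi> S - \<Phi> (S(i := t)) = altruistic_cost G \<Gamma> i S - altruistic_cost G \<Gamma> i (S(i := t)))"

end

theory Submission
  imports Defs
begin

text \<open>
  Let \<open>x\<^sub>j(e)\<close> be 1 if player \<open>j\<close> uses \<open>e\<close> and 0 otherwise. The cost of player \<open>i\<close> is a sum over
  the resources of \<open>\<alpha>\<^sub>e \<Sum>\<^sub>j\<^sub>k \<gamma>\<^sub>i\<^sub>j x\<^sub>j x\<^sub>k + \<beta>\<^sub>e \<Sum>\<^sub>j \<gamma>\<^sub>i\<^sub>j x\<^sub>j\<close>. As \<open>\<gamma>\<^sub>i\<^sub>i = 1\<close>, the part of the summand that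
  involves \<open>x\<^sub>i\<close> is \<open>\<alpha>\<^sub>e (x\<^sub>i\<^sup>2 + x\<^sub>i \<Sum>\<^sub>k\<^sub>\<noteq>\<^sub>i (1 + \<gamma>\<^sub>i\<^sub>k) x\<^sub>k) + \<beta>\<^sub>e x\<^sub>i\<close>. Its interaction coefficients
  \<open>1 + \<gamma>\<^sub>i\<^sub>k\<close> are symmetric, so it is also the part involving \<open>x\<^sub>i\<close> of the function
  \<open>\<alpha>\<^sub>e / 2 \<Sum>\<^sub>j\<^sub>k (1 + \<gamma>\<^sub>j\<^sub>k) x\<^sub>j x\<^sub>k + \<beta>\<^sub>e \<Sum>\<^sub>j x\<^sub>j\<close>, which does not depend on \<open>i\<close>.
\<close>

text \<open>The sum runs over ordered pairs and \<open>a\<close> may be asymmetric, so costs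
  (coefficients \<open>\<Gamma> i j\<close>, constant in \<open>k\<close>) and the potential are
  both instances.\<close>

definition quadratic_form :: "'a set \<Rightarrow> ('a \<Rightarrow> 'a \<Rightarrow> real) \<Rightarrow> ('a \<Rightarrow> real) \<Rightarrow> real" where
  "quadratic_form P a x = (\<Sum>j\<in>P. \<Sum>k\<in>P. a j k * x j * x k)"

lemma quadratic_form_remove:
  assumes "finite P" "i \<in> P"
  shows "quadratic_form P a x =
    a i i * (x i)\<^sup>2 + x i * (\<Sum>k\<in>P - {i}. (a i k + a k i) * x k) + quadratic_form (P - {i}) a x"
  using assms
  by (simp add: quadratic_form_def sum.remove[of P i] sum.distrib sum_distrib_left
      power2_eq_square algebra_simps)

text \<open>Terms avoiding \<open>i\<close> cancel, and the cross sum takes the same value at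
  \<open>x\<close> and \<open>y\<close>. So the change depends on \<open>a\<close> only through
  \<open>a i i\<close> and the sums \<open>a i k + a k i\<close>.\<close>

lemma quadratic_form_diff:
  assumes "finite P" "i \<in> P" and agree: "\<And>k. k \<in> P - {i} \<Longrightarrow> x k = y k"
  shows "quadratic_form P a x - quadratic_form P a y =
    a i i * ((x i)\<^sup>2 - (y i)\<^sup>2) + (x i - y i) * (\<Sum>k\<in>P - {i}. (a i k + a k i) * x k)"
proof -
  have "quadratic_form (P - {i}) a x = quadratic_form (P - {i}) a y"
    unfolding quadratic_form_def by (intro sum.cong refl) (simp add: agree)
  moreover have "(\<Sum>k\<in>P - {i}. (a i k + a k i) * x k) = (\<Sum>k\<in>P - {i}. (a i k + a k i) * y k)"
    by (intro sum.cong refl) (simp add: agree)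
  ultimately show ?thesis
    using assms(1,2) by (simp add: quadratic_form_remove[of P i] algebra_simps)
qed

lemma sum_diff_at:
  fixes b :: "'a \<Rightarrow> real"
  assumes "finite P" "i \<in> P" "\<And>k. k \<in> P - {i} \<Longrightarrow> x k = y k"
  shows "(\<Sum>j\<in>P. b j * x j) - (\<Sum>j\<in>P. b j * y j) = b i * (x i - y i)"
proof -
  have "(\<Sum>j\<in>P - {i}. b j * x j) = (\<Sum>j\<in>P - {i}. b j * y j)"
    by (intro sum.cong refl) (simp add: assms(3))
  then show ?thesis
    using assms(1,2) by (simp add: sum.remove[of P i] algebra_simps)
qed

lemma finite_players [simp]: "finite (players G)"
  by (simp add: players_def)

definition usage :: "(nat \<Rightarrow> 'e set) \<Rightarrow> 'e \<Rightarrow> nat \<Rightarrow> real" where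
  "usage S e j = of_bool (e \<in> S j)"

lemma congestion_eq_sum_usage: "real (congestion G S e) = (\<Sum>j\<in>players G. usage S e j)"
  by (simp add: congestion_def usage_def Int_def)

lemma profile_subset_resources:
  assumes "linear_congestion_game G" "S \<in> profiles G" "j \<in> players G"
  shows "S j \<subseteq> resources G"
  using assms by (fastforce simp: linear_congestion_game_def profiles_def PiE_iff)

lemma profile_update:
  assumes "S \<in> profiles G" "i \<in> players G" "t \<in> strategies G i"
  shows "S(i := t) \<in> profiles G"
  using assms by (auto simp: profiles_def PiE_iff extensional_def)

text \<open>The indicator extends the sum to a range independent of the strategy, which later allows
  players and resources to be swapped.\<close>

lemma cost_eq_sum_resources:
  assumes "finite (resources G)" "S j \<subseteq> resources G"
  shows "cost G j S =
    (\<Sum>e\<in>resources G. usage S e j * latency G e (\<Sum>k\<in>players G. usage S e k))"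
proof -
  have "cost G j S = (\<Sum>e\<in>S j. usage S e j * latency G e (\<Sum>k\<in>players G. usage S e k))"
    by (simp add: cost_def congestion_eq_sum_usage usage_def)
  also have "\<dots> =
      (\<Sum>e\<in>resources G. usage S e j * latency G e (\<Sum>k\<in>players G. usage S e k))"
    using assms by (intro sum.mono_neutral_left) (auto simp: usage_def)
  finally show ?thesis .
qed

text \<open>Linear latency makes each summand quadratic in the usages: \<open>j\<close> is the
  player bearing the cost, weighted by \<open>\<Gamma> i j\<close>, and \<open>k\<close> comes from
  the congestion.\<close>

lemma altruistic_cost_eq_sum_resources:
  assumes "linear_congestion_game G" "S \<in> profiles G"
  shows "altruistic_cost G \<Gamma> i S =
    (\<Sum>e\<in>resources G. slope G e * quadratic_form (players G) (\<lambda>j k. \<Gamma> i j) (usage S e)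
                     + offset G e * (\<Sum>j\<in>players G. \<Gamma> i j * usage S e j))"
proof -
  have fin: "finite (resources G)"
    using assms(1) by (simp add: linear_congestion_game_def)
  have "altruistic_cost G \<Gamma> i S =
      (\<Sum>j\<in>players G. \<Sum>e\<in>resources G.
         \<Gamma> i j * (usage S e j * latency G e (\<Sum>k\<in>players G. usage S e k)))"
    unfolding altruistic_cost_def sum_distrib_left[symmetric]
    by (intro sum.cong refl)
       (simp add: cost_eq_sum_resources[OF fin profile_subset_resources[OF assms]])
  also have "\<dots> = (\<Sum>e\<in>resources G. \<Sum>j\<in>players G.
         \<Gamma> i j * (usage S e j * latency G e (\<Sum>k\<in>players G. usage S e k)))"
    by (rule sum.swap)
  also have "\<dots> =
      (\<Sum>e\<in>resources G. slope G e * quadratic_form (players G) (\<lambda>j k. \<Gamma> i j) (usage S e)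
                       + offset G e * (\<Sum>j\<in>players G. \<Gamma> i j * usage S e j))"
    by (intro sum.cong refl)
       (simp add: latency_def quadratic_form_def sum_distrib_left sum.distrib algebra_simps)
  finally show ?thesis .
qed

text \<open>Halving compensates for counting each pair twice. If \<open>\<Gamma>\<close> is the
  identity matrix on the players, this is Rosenthal's potential.\<close>

definition altruistic_potential ::
  "'e congestion_game \<Rightarrow> (nat \<Rightarrow> nat \<Rightarrow> real) \<Rightarrow> (nat \<Rightarrow> 'e set) \<Rightarrow> real" where
  "altruistic_potential G \<Gamma> S =
    (\<Sum>e\<in>resources G. slope G e / 2 * quadratic_form (players G) (\<lambda>j k. 1 + \<Gamma> j k) (usage S e)
                     + offset G e * (\<Sum>j\<in>players G. usage S e j))"

lemma exact_potential_altruistic_potential: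
  assumes game: "linear_congestion_game G"
    and norm: "normalized_context G \<Gamma>"
    and sym: "symmetric_context G \<Gamma>"
  shows "exact_potential G \<Gamma> (altruistic_potential G \<Gamma>)"
  unfolding exact_potential_def
proof (intro ballI)
  fix S i t
  assume S: "S \<in> profiles G" and i: "i \<in> players G" and t: "t \<in> strategies G i"
  define T where "T = S(i := t)"
  have T: "T \<in> profiles G"
    unfolding T_def using S i t by (rule profile_update)
  have ii: "\<Gamma> i i = 1"
    using norm i by (simp add: normalized_context_def)
  \<comment> \<open>The potential property already holds resource by resource.\<close>
  have "slope G e / 2 * quadratic_form (players G) (\<lambda>j k. 1 + \<Gamma> j k) (usage S e)
          + offset G e * (\<Sum>j\<in>players G. usage S e j)
        - (slope G e / 2 * quadratic_form (players G) (\<lambda>j k. 1 + \<Gamma> j k) (usage T e)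
          + offset G e * (\<Sum>j\<in>players G. usage T e j))
      = slope G e * quadratic_form (players G) (\<lambda>j k. \<Gamma> i j) (usage S e)
          + offset G e * (\<Sum>j\<in>players G. \<Gamma> i j * usage S e j)
        - (slope G e * quadratic_form (players G) (\<lambda>j k. \<Gamma> i j) (usage T e)
          + offset G e * (\<Sum>j\<in>players G. \<Gamma> i j * usage T e j))" for e
  proof -
    let ?P = "players G" and ?x = "usage S e" and ?y = "usage T e"
    let ?A = "quadratic_form ?P (\<lambda>j k. 1 + \<Gamma> j k)" and ?C = "quadratic_form ?P (\<lambda>j k. \<Gamma> i j)"
    have agree: "\<And>k. k \<in> ?P - {i} \<Longrightarrow> ?x k = ?y k"
      by (simp add: T_def usage_def)
    \<comment> \<open>Symmetry merges the two entries; the remaining 1 is written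
      \<open>\<Gamma> i i\<close> to match the cross sum produced by \<open>?C\<close>.\<close>
    have "(\<Sum>k\<in>?P - {i}. ((1 + \<Gamma> i k) + (1 + \<Gamma> k i)) * ?x k)
        = (\<Sum>k\<in>?P - {i}. 2 * ((\<Gamma> i i + \<Gamma> i k) * ?x k))"
      using sym i ii by (intro sum.cong refl) (simp add: symmetric_context_def algebra_simps)
    also have "\<dots> = 2 * (\<Sum>k\<in>?P - {i}. (\<Gamma> i i + \<Gamma> i k) * ?x k)"
      by (rule sum_distrib_left[symmetric])
    finally have cross: "(\<Sum>k\<in>?P - {i}. ((1 + \<Gamma> i k) + (1 + \<Gamma> k i)) * ?x k)
        = 2 * (\<Sum>k\<in>?P - {i}. (\<Gamma> i i + \<Gamma> i k) * ?x k)" .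
    have "?A ?x - ?A ?y = (1 + \<Gamma> i i) * ((?x i)\<^sup>2 - (?y i)\<^sup>2)
        + (?x i - ?y i) * (2 * (\<Sum>k\<in>?P - {i}. (\<Gamma> i i + \<Gamma> i k) * ?x k))"
      using quadratic_form_diff[where a = "\<lambda>j k. 1 + \<Gamma> j k", OF finite_players i, of ?x ?y, OF agree]
      unfolding cross .
    moreover have "?C ?x - ?C ?y = \<Gamma> i i * ((?x i)\<^sup>2 - (?y i)\<^sup>2)
        + (?x i - ?y i) * (\<Sum>k\<in>?P - {i}. (\<Gamma> i i + \<Gamma> i k) * ?x k)"
      by (rule quadratic_form_diff[OF finite_players i agree])
    \<comment> \<open>Since \<open>1 + \<Gamma> i i = 2\<close>, the diagonal part doubles just as
      the cross part does.\<close>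
    ultimately have "?A ?x - ?A ?y = 2 * (?C ?x - ?C ?y)"
      by (simp only: ii) (simp add: algebra_simps)
    then have "slope G e / 2 * (?A ?x - ?A ?y) = slope G e * (?C ?x - ?C ?y)"
      by simp
    \<comment> \<open>Only the term of \<open>i\<close> changes, with weight 1 on the left and
      \<open>\<Gamma> i i = 1\<close> on the right.\<close>
    moreover have "(\<Sum>j\<in>?P. ?x j) - (\<Sum>j\<in>?P. ?y j)
        = (\<Sum>j\<in>?P. \<Gamma> i j * ?x j) - (\<Sum>j\<in>?P. \<Gamma> i j * ?y j)"
      using sum_diff_at[where b = "\<lambda>_. 1", OF finite_players i, of ?x ?y, OF agree]
        sum_diff_at[where b = "\<Gamma> i", OF finite_players i, of ?x ?y, OF agree] ii
      by simp
    then have "offset G e * ((\<Sum>j\<in>?P. ?x j) - (\<Sum>j\<in>?P. ?y j))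
        = offset G e * ((\<Sum>j\<in>?P. \<Gamma> i j * ?x j) - (\<Sum>j\<in>?P. \<Gamma> i j * ?y j))"
      by simp
    ultimately show ?thesis
      unfolding right_diff_distrib by linarith
  qed
  then have "altruistic_potential G \<Gamma> S - altruistic_potential G \<Gamma> T
      = altruistic_cost G \<Gamma> i S - altruistic_cost G \<Gamma> i T"
    by (simp only: altruistic_potential_def altruistic_cost_eq_sum_resources[OF game S]
        altruistic_cost_eq_sum_resources[OF game T] sum_subtractf[symmetric])
  then show "altruistic_potential G \<Gamma> S - altruistic_potential G \<Gamma> (S(i := t))
      = altruistic_cost G \<Gamma> i S - altruistic_cost G \<Gamma> i (S(i := t))"
    unfolding T_def .
qed

theorem theorem1:
  fixes G :: "'e congestion_game" and \<Gamma> :: "nat \<Rightarrow> nat \<Rightarrow> real"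
  assumes "altruistic_game G \<Gamma>"
    and "restricted_context G \<Gamma>"
    and "normalized_context G \<Gamma>"
    and "symmetric_context G \<Gamma>"
  shows "\<exists>\<Phi>. exact_potential G \<Gamma> \<Phi>"
  using exact_potential_altruistic_potential[OF _ assms(3,4)] assms(1)
  by (auto simp: altruistic_game_def)

end
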